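(* Let $n\ge1$ and $m>2^n$ be integers. Kronecker holds a list of $m$ vectors $v_1,\ldots,v_m\in\{0,1\}^n$; Cantor adaptively queries entries ``bit $j$ of vector $i$'', and his goal is to determine whether $\{v_1,\ldots,v_m\}\supseteq\{0,1\}^n$. Suppose Kronecker answers according to the ``0 first'' strategy (defined in the context). Then for every (adaptive) strategy of Cantor, Cantor must make all $mn$ queries in order to determine whether the list contains every vector of $\{0,1\}^n$; that is, after any fewer than $mn$ queries, the answers given so far are consistent both with a list containing all of $\{0,1\}^n$ and with a list not containing all of $\{0,1\}^n$.
   Context: The state of the game is an $m\times n$ matrix $L$ with entries in $\{0,1,\star\}$, where $L(i,j)=\star$ means bit $j$ of $v_i$ has not been queried yet and otherwise $L(i,j)$ is Kronecker's answer; initially all entries are $\star$, and each query is to an entry currently equal to $\star$. Row $i$ of $L$ is denoted $L(i)$. A set $S$ of $2^n$ rows of $L$ is useful if, after replacing each $\star$ in the rows of $S$ by $0$ or $1$ suitably, the rows of $S$ are exactly the $2^n$ distinct vectors of $\{0,1\}^n$. $L$ is unblocked if it has a useful set of rows, and blocked otherwise. The ``0 first'' strategy of Kronecker: when Cantor queries entry $(i,j)$, Kronecker answers $1$ if setting $L(i,j)$ to $0$ would make $L$ blocked, and answers $0$ otherwise. *)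

theory Defs
  imports Main "HOL-Library.FuncSet"
begin

text \<open>
  Bits are Booleans (\<^const>\<open>False\<close> is 0, \<^const>\<open>True\<close> is 1), indices start at 0, and an unqueried
  entry (a star) is \<^const>\<open>None\<close>. Of a board only the entries below \<open>m\<close> and \<open>n\<close> are meaningful.
\<close>

type_synonym board = "nat \<Rightarrow> nat \<Rightarrow> bool option"

definition cube :: "nat \<Rightarrow> (nat \<Rightarrow> bool) set" where
  "cube n = {..<n} \<rightarrow>\<^sub>E UNIV"

definition completes_row :: "nat \<Rightarrow> (nat \<Rightarrow> bool option) \<Rightarrow> (nat \<Rightarrow> bool) \<Rightarrow> bool" where
  "completes_row n r x \<longleftrightarrow> x \<in> cube n \<and> (\<forall>j<n. \<forall>b. r j = Some b \<longrightarrow> x j = b)"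

definition useful :: "nat \<Rightarrow> nat \<Rightarrow> board \<Rightarrow> nat set \<Rightarrow> bool" where
  "useful m n L S \<longleftrightarrow> S \<subseteq> {..<m} \<and> card S = 2 ^ n \<and>
     (\<exists>f. (\<forall>i\<in>S. completes_row n (L i) (f i)) \<and> bij_betw f S (cube n))"

definition unblocked :: "nat \<Rightarrow> nat \<Rightarrow> board \<Rightarrow> bool" where
  "unblocked m n L \<longleftrightarrow> (\<exists>S. useful m n L S)"

abbreviation blocked :: "nat \<Rightarrow> nat \<Rightarrow> board \<Rightarrow> bool" where
  "blocked m n L \<equiv> \<not> unblocked m n L"

definition set_entry :: "board \<Rightarrow> nat \<Rightarrow> nat \<Rightarrow> bool \<Rightarrow> board" where
  "set_entry L i j b = L(i := (L i)(j := Some b))"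

definition zero_first :: "nat \<Rightarrow> nat \<Rightarrow> board \<Rightarrow> nat \<Rightarrow> nat \<Rightarrow> bool" where
  "zero_first m n L i j = (if blocked m n (set_entry L i j False) then True else False)"

text \<open>
  A history lists the queries made so far, in chronological order, together with their answers.
  A strategy of Cantor maps the history to his next query, or to \<^const>\<open>None\<close> if he stops.
\<close>

type_synonym history = "(nat \<times> nat \<times> bool) list"
type_synonym strategy = "history \<Rightarrow> (nat \<times> nat) option"

text \<open>
  \<open>play m n \<sigma> h L\<close>: with Cantor following \<open>\<sigma>\<close> and Kronecker answering ``0 first'', the game passes
  through the history \<open>h\<close>, with \<open>L\<close> the board at that moment. Only queries to an entry that is
  currently a star are admitted.
\<close>

inductive play :: "nat \<Rightarrow> nat \<Rightarrow> strategy \<Rightarrow> history \<Rightarrow> board \<Rightarrow> bool"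
  for m n :: nat and \<sigma> :: strategy where
  start: "play m n \<sigma> [] (\<lambda>i j. None)"
| query: "\<lbrakk> play m n \<sigma> h L; \<sigma> h = Some (i, j); i < m; j < n; L i j = None;
            b = zero_first m n L i j \<rbrakk>
          \<Longrightarrow> play m n \<sigma> (h @ [(i, j, b)]) (set_entry L i j b)"

definition consistent_list :: "nat \<Rightarrow> nat \<Rightarrow> history \<Rightarrow> (nat \<Rightarrow> nat \<Rightarrow> bool) \<Rightarrow> bool" where
  "consistent_list m n h v \<longleftrightarrow>
     (\<forall>i<m. v i \<in> cube n) \<and> (\<forall>(i, j, b) \<in> set h. v i j = b)"

end

theory Submission imports Defs begin

text \<open>
  Under ``0 first'' the board stays unblocked, and turning any answered 1 into a 0 would block it.
  Let \<open>(i, j)\<close> be a star, and suppose that every completion of the board covers the cube. Fill all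
  stars with 0, and let \<open>y\<close> be row \<open>i\<close> with bit \<open>j\<close> flipped to 1. Some row \<open>k \<noteq> i\<close> equals \<open>y\<close>, and
  its bit \<open>j\<close> must be an answered 1. Now fill \<open>(i, j)\<close> with 1 instead: rows \<open>i\<close> and \<open>k\<close> coincide, so
  the cube is covered without row \<open>k\<close>, and the 1 at \<open>(k, j)\<close> could be turned into a 0.
\<close>

lemma finite_cube: "finite (cube n)"
  unfolding cube_def by (rule finite_PiE) auto

lemma card_cube: "card (cube n) = 2 ^ n"
  unfolding cube_def by (subst card_PiE) auto

lemma fun_upd_in_cube:
  assumes "x \<in> cube n" and "j < n"
  shows "x(j := b) \<in> cube n"
  using assms by (auto simp: cube_def PiE_iff extensional_def)

lemma completes_row_map_le:
  assumes "completes_row n r' x" and "r \<subseteq>\<^sub>m r'"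
  shows "completes_row n r x"
  using assms by (force simp: completes_row_def map_le_def dom_def)

lemma completes_row_fun_upd:
  assumes "completes_row n r x" and "j < n"
  shows "completes_row n (r(j \<mapsto> b)) (x(j := b))"
  using assms by (simp add: completes_row_def fun_upd_in_cube)

lemma set_entry_map_le:
  assumes "L i j = None"
  shows "L k \<subseteq>\<^sub>m set_entry L i j b k"
  using assms by (auto simp: set_entry_def map_le_def)

definition completion :: "nat \<Rightarrow> nat \<Rightarrow> board \<Rightarrow> (nat \<Rightarrow> nat \<Rightarrow> bool) \<Rightarrow> bool" where
  "completion m n L v \<longleftrightarrow> (\<forall>i<m. completes_row n (L i) (v i))"

abbreviation (input) covering :: "nat \<Rightarrow> nat \<Rightarrow> (nat \<Rightarrow> nat \<Rightarrow> bool) \<Rightarrow> bool" where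
  "covering m n v \<equiv> cube n \<subseteq> v ` {..<m}"

definition zero_fill :: "nat \<Rightarrow> board \<Rightarrow> nat \<Rightarrow> nat \<Rightarrow> bool" where
  "zero_fill n L i = (\<lambda>j\<in>{..<n}. L i j = Some True)"

lemma completion_zero_fill: "completion m n L (zero_fill n L)"
  by (simp add: completion_def completes_row_def zero_fill_def cube_def)

lemma completion_map_le:
  assumes "completion m n L' v" and "\<And>i. L i \<subseteq>\<^sub>m L' i"
  shows "completion m n L v"
  using assms completes_row_map_le by (auto simp: completion_def)

lemma completion_set_entry:
  assumes "completion m n L v" and "j < n"
  shows "completion m n (set_entry L i j b) (v(i := (v i)(j := b)))"
  using assms by (simp add: completion_def set_entry_def completes_row_fun_upd)

lemma completion_fill_star:
  assumes "completion m n L v" and "j < n" and "L i j = None"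
  shows "completion m n L (v(i := (v i)(j := b)))"
  using completion_set_entry[OF assms(1,2)] set_entry_map_le[of L, OF assms(3)]
  by (rule completion_map_le)

lemma unblocked_iff_covering_completion:
  "unblocked m n L \<longleftrightarrow> (\<exists>v. completion m n L v \<and> covering m n v)"
proof
  assume "unblocked m n L"
  then obtain S f where S: "S \<subseteq> {..<m}" and f: "\<And>i. i \<in> S \<Longrightarrow> completes_row n (L i) (f i)"
    and bij: "bij_betw f S (cube n)"
    by (auto simp: unblocked_def useful_def)
  define v where "v = (\<lambda>i. if i \<in> S then f i else zero_fill n L i)"
  have "completion m n L v"
    using f completion_zero_fill[of m n L] by (auto simp: completion_def v_def)
  moreover have "v ` S = cube n"
    using bij by (auto simp: v_def bij_betw_def)
  ultimately show "\<exists>v. completion m n L v \<and> covering m n v"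
    using S by (metis image_mono)
next
  assume "\<exists>v. completion m n L v \<and> covering m n v"
  then obtain v where v: "completion m n L v" "covering m n v" by blast
  obtain S where S: "S \<subseteq> {..<m}" "inj_on v S" "cube n = v ` S"
    using v(2) by (auto simp: subset_image_inj)
  then have "bij_betw v S (cube n)" and "card S = 2 ^ n"
    by (simp_all add: bij_betw_def card_image flip: card_cube)
  then show "unblocked m n L"
    using S(1) v(1) unfolding unblocked_def useful_def completion_def by blast
qed

lemma unblocked_map_le:
  assumes "unblocked m n L'" and "\<And>i. L i \<subseteq>\<^sub>m L' i"
  shows "unblocked m n L"
  using assms completion_map_le unfolding unblocked_iff_covering_completion by blast

lemma unblocked_all_stars:
  assumes "2 ^ n \<le> m"
  shows "unblocked m n (\<lambda>i j. None)"
proof -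
  obtain f where f: "bij_betw f {..<2 ^ n :: nat} (cube n)"
    using ex_bij_betw_nat_finite[OF finite_cube[of n]]
    by (auto simp: card_cube lessThan_atLeast0)
  have "useful m n (\<lambda>i j. None) {..<2 ^ n}"
    unfolding useful_def completes_row_def using f assms
    by (intro conjI exI[of _ f]) (auto simp: bij_betw_def)
  then show ?thesis by (auto simp: unblocked_def)
qed

lemma unblocked_set_entry_cases:
  assumes "unblocked m n L" and "j < n"
  obtains b where "unblocked m n (set_entry L i j b)"
proof -
  obtain v where "completion m n L v" and cover: "covering m n v"
    using assms(1) unfolding unblocked_iff_covering_completion by blast
  then have "completion m n (set_entry L i j (v i j)) v"
    using completion_set_entry[of m n L v j i "v i j"] assms(2) by simp
  with cover have "unblocked m n (set_entry L i j (v i j))"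
    unfolding unblocked_iff_covering_completion by blast
  then show thesis by (rule that)
qed

lemma zero_first_iff: "zero_first m n L i j \<longleftrightarrow> blocked m n (set_entry L i j False)"
  by (simp add: zero_first_def)

lemma unblocked_zero_first:
  assumes "unblocked m n L" and "j < n"
  shows "unblocked m n (set_entry L i j (zero_first m n L i j))"
proof -
  obtain b where "unblocked m n (set_entry L i j b)"
    using assms by (rule unblocked_set_entry_cases)
  then show ?thesis
    by (cases b; cases "zero_first m n L i j") (simp_all add: zero_first_iff)
qed

definition ones_forced :: "nat \<Rightarrow> nat \<Rightarrow> board \<Rightarrow> bool" where
  "ones_forced m n L \<longleftrightarrow>
     (\<forall>i<m. \<forall>j<n. L i j = Some True \<longrightarrow> blocked m n (set_entry L i j False))"

lemma ones_forced_zero_first: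
  assumes "ones_forced m n L" and "L i j = None"
  shows "ones_forced m n (set_entry L i j (zero_first m n L i j))"
  unfolding ones_forced_def
proof (intro allI impI)
  let ?L = "set_entry L i j (zero_first m n L i j)"
  fix k l assume "k < m" "l < n" and one: "?L k l = Some True"
  show "blocked m n (set_entry ?L k l False)"
  proof (cases "(k, l) = (i, j)")
    case True
    then have "zero_first m n L i j" and "set_entry ?L k l False = set_entry L i j False"
      using one by (auto simp: set_entry_def)
    then show ?thesis by (simp add: zero_first_iff)
  next
    case False
    then have "L k l = Some True"
      using one by (auto simp: set_entry_def split: if_splits)
    then have "blocked m n (set_entry L k l False)"
      using assms(1) \<open>k < m\<close> \<open>l < n\<close> by (simp add: ones_forced_def)
    moreover have "set_entry L k l False a \<subseteq>\<^sub>m set_entry ?L k l False a" for a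
      using assms(2) by (auto simp: set_entry_def map_le_def)
    ultimately show ?thesis using unblocked_map_le by blast
  qed
qed

lemma image_subset_fun_upd_duplicate:
  assumes "i \<in> A" and "i \<noteq> k" and "f i = f k"
  shows "f ` A \<subseteq> f(k := y) ` A"
proof (rule image_subsetI)
  fix a assume "a \<in> A"
  define a' where "a' = (if a = k then i else a)"
  have "a' \<in> A" and "f a = (f(k := y)) a'"
    using assms \<open>a \<in> A\<close> by (auto simp: a'_def)
  then show "f a \<in> f(k := y) ` A" by blast
qed

lemma no_answered_one_in_duplicate_row:
  assumes forced: "ones_forced m n L"
    and v: "completion m n L v" "covering m n v"
    and dup: "v i = v k" "i \<noteq> k"
    and "i < m" "k < m" "j < n"
  shows "L k j \<noteq> Some True"
proof
  assume "L k j = Some True"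
  then have "blocked m n (set_entry L k j False)"
    using forced \<open>k < m\<close> \<open>j < n\<close> by (simp add: ones_forced_def)
  moreover have "completion m n (set_entry L k j False) (v(k := (v k)(j := False)))"
    using v(1) \<open>j < n\<close> by (rule completion_set_entry)
  moreover have "covering m n (v(k := (v k)(j := False)))"
    using v(2) image_subset_fun_upd_duplicate[of i "{..<m}" k v] dup \<open>i < m\<close> by blast
  ultimately show False
    unfolding unblocked_iff_covering_completion by blast
qed

lemma star_imp_noncovering_completion:
  assumes forced: "ones_forced m n L"
    and "i < m" "j < n" and star: "L i j = None"
  shows "\<exists>v. completion m n L v \<and> \<not> covering m n v"
proof (rule ccontr)
  assume "\<not> ?thesis"
  then have all_covering: "covering m n v" if "completion m n L v" for v
    using that by blast
  let ?z = "zero_fill n L"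
  define y where "y = (?z i)(j := True)"
  have z': "completion m n L (?z(i := y))"
    unfolding y_def using completion_zero_fill \<open>j < n\<close> star by (rule completion_fill_star)
  then have "y \<in> cube n"
    using \<open>i < m\<close> by (auto simp: completion_def completes_row_def)
  then obtain k where k: "k < m" "?z k = y"
    using all_covering[OF completion_zero_fill] by blast
  have "?z k j" using k(2) by (simp add: y_def)
  then have one: "L k j = Some True" using \<open>j < n\<close> by (simp add: zero_fill_def)
  then have "i \<noteq> k" using star by auto
  then have "L k j \<noteq> Some True"
    using no_answered_one_in_duplicate_row[OF forced z' all_covering[OF z'], of i k j]
      \<open>i < m\<close> \<open>j < n\<close> k by simp
  with one show False by simp
qed

lemma play_unblocked:
  assumes "play m n \<sigma> h L" and "2 ^ n \<le> m"
  shows "unblocked m n L"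
  using assms
  by (induction rule: play.induct) (auto intro: unblocked_all_stars unblocked_zero_first)

lemma play_ones_forced:
  assumes "play m n \<sigma> h L"
  shows "ones_forced m n L"
  using assms
proof (induction rule: play.induct)
  case start
  show ?case by (simp add: ones_forced_def)
qed (auto intro: ones_forced_zero_first)

lemma play_in_history_iff:
  assumes "play m n \<sigma> h L"
  shows "(i, j, b) \<in> set h \<longleftrightarrow> L i j = Some b"
  using assms
  by (induction arbitrary: i j b rule: play.induct) (auto simp: set_entry_def)

lemma play_history_in_range:
  assumes "play m n \<sigma> h L" and "(i, j, b) \<in> set h"
  shows "i < m" and "j < n"
  using assms by (induction arbitrary: i j b rule: play.induct) auto

lemma play_has_star:
  assumes "play m n \<sigma> h L" and "length h < m * n"
  obtains i j where "i < m" "j < n" "L i j = None"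
proof -
  let ?queried = "(\<lambda>(i, j, b). (i, j)) ` set h"
  have "card ?queried \<le> length h"
    using card_image_le[OF finite_set] card_length by (rule order_trans)
  then have "card ?queried < card ({..<m} \<times> {..<n})"
    using assms(2) by (simp add: card_cartesian_product)
  then have "\<not> {..<m} \<times> {..<n} \<subseteq> ?queried"
    using card_mono[of ?queried "{..<m} \<times> {..<n}"] by auto
  then obtain i j where "i < m" "j < n" and unqueried: "(i, j) \<notin> ?queried"
    by auto
  have "L i j \<noteq> Some b" for b
    using unqueried play_in_history_iff[OF assms(1), of i j b] by force
  then have "L i j = None" by auto
  with \<open>i < m\<close> \<open>j < n\<close> show thesis by (rule that)
qed

lemma consistent_list_iff_completion:
  assumes "play m n \<sigma> h L"
  shows "consistent_list m n h v \<longleftrightarrow> completion m n L v"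
proof -
  have "(\<forall>(i, j, b) \<in> set h. v i j = b) \<longleftrightarrow> (\<forall>i j b. (i, j, b) \<in> set h \<longrightarrow> v i j = b)"
    by auto
  also have "\<dots> \<longleftrightarrow> (\<forall>i<m. \<forall>j<n. \<forall>b. L i j = Some b \<longrightarrow> v i j = b)"
    unfolding play_in_history_iff[OF assms, symmetric]
    using play_history_in_range[OF assms] by blast
  finally show ?thesis
    unfolding consistent_list_def completion_def completes_row_def by blast
qed

theorem theorem4p5:
  fixes m n :: nat and \<sigma> :: strategy and h :: history and L :: board
  assumes "n \<ge> 1" and "m > 2 ^ n"
    and "play m n \<sigma> h L"
    and "length h < m * n"
  shows "(\<exists>v. consistent_list m n h v \<and> cube n \<subseteq> v ` {..<m}) \<and>
         (\<exists>v. consistent_list m n h v \<and> \<not> cube n \<subseteq> v ` {..<m})"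
  unfolding consistent_list_iff_completion[OF assms(3)]
proof
  have "unblocked m n L"
    using assms(2,3) by (simp add: play_unblocked)
  then show "\<exists>v. completion m n L v \<and> covering m n v"
    by (simp add: unblocked_iff_covering_completion)
next
  obtain i j where "i < m" "j < n" "L i j = None"
    using assms(3,4) by (rule play_has_star)
  with play_ones_forced[OF assms(3)] show "\<exists>v. completion m n L v \<and> \<not> covering m n v"
    by (rule star_imp_noncovering_completion)
qed

end
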